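(* Let $K$ be a finite field with $q$ elements and let $(\sigma,\alpha)$ be a collection of hypermaps on the set $\{1,2,\ldots,n\}$ such that each cycle of $\alpha$ has at most three elements. Then $C(\sigma,\alpha;q)$ is the number of nowhere zero flows $f:\{1,2,\ldots,n\}\rightarrow K$ on $(\sigma,\alpha)$.
   Context: Permutations act on a finite set and are composed from right to left; $z(\pi)$ is the number of cycles of $\pi$ (fixed points included). A collection of hypermaps on $\{1,\ldots,n\}$ is an ordered pair $(\sigma,\alpha)$ of permutations of $\{1,\ldots,n\}$; $\kappa(\sigma,\alpha)$ is the number of orbits of the group generated by $\sigma$ and $\alpha$. A permutation $\beta$ is a refinement of $\alpha$ ($\beta\le\alpha$) if $\beta$ is obtained by replacing each cycle $\alpha_i$ of $\alpha$ by a permutation $\beta_i$ of the same set of $n_i$ points with $z(\beta_i)+z(\beta_i^{-1}\alpha_i)=n_i+1$. Refinement is a partial order; $\mu(\beta,\alpha)$ denotes the Möbius function of the interval $[\beta,\alpha]$ in this order. The flow polynomial of $(\sigma,\alpha)$ is $$C(\sigma,\alpha;t)=\sum_{\beta\leq\alpha}\mu(\beta,\alpha)\,t^{n+\kappa(\sigma,\beta)-z(\beta)-z(\sigma)}.$$ A flow on $(\sigma,\alpha)$ over a field $K$ is a function $f:\{1,\ldots,n\}\to K$ such that $\sum_{i\in C}f(i)=0$ for the set $C$ of points of each cycle of $\sigma$ and of each cycle of $\alpha$ (cycles of length $1$ included). A flow $f$ is a nowhere zero flow if $f(i)=0$ implies that $(i)$ is a cycle of $\alpha$. *)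

theory Defs
  imports
    "HOL-Combinatorics.Orbits"
    "HOL-Algebra.Sym_Groups"
    "HOL-Algebra.Group_Action"
    "HOL-Library.Cardinality"
    "HOL-Computational_Algebra.Polynomial"
begin

text \<open>
  Fixed points are included: \<^term>\<open>Orbits.orbit p x\<close> is \<^term>\<open>{x}\<close> if \<^term>\<open>p x = x\<close>.
\<close>

definition cycles :: "'a set \<Rightarrow> ('a \<Rightarrow> 'a) \<Rightarrow> 'a set set" where
  "cycles S p = Orbits.orbit p ` S"

definition ncycles :: "'a set \<Rightarrow> ('a \<Rightarrow> 'a) \<Rightarrow> nat" where
  "ncycles S p = card (cycles S p)"

definition nclasses :: "nat \<Rightarrow> (nat \<Rightarrow> nat) \<Rightarrow> (nat \<Rightarrow> nat) \<Rightarrow> nat" where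
  "nclasses n \<sigma> \<alpha> =
     card (orbits ((sym_group n)\<lparr>carrier := generate (sym_group n) {\<sigma>, \<alpha>}\<rparr>) {1..n} (\<lambda>p. p))"

text \<open>
  For a cycle \<^term>\<open>C\<close> of \<open>\<alpha>\<close>, \<^term>\<open>perm_restrict \<alpha> C\<close> is that cycle as a permutation of
  \<^term>\<open>C\<close>, and \<^term>\<open>perm_restrict \<beta> C\<close> is the permutation of \<^term>\<open>C\<close> that replaces it.
\<close>

definition refines :: "nat \<Rightarrow> (nat \<Rightarrow> nat) \<Rightarrow> (nat \<Rightarrow> nat) \<Rightarrow> bool" where
  "refines n \<beta> \<alpha> \<longleftrightarrow>
     \<alpha> permutes {1..n} \<and> \<beta> permutes {1..n} \<and>
     (\<forall>C\<in>cycles {1..n} \<alpha>.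
        perm_restrict \<beta> C permutes C \<and>
        ncycles C (perm_restrict \<beta> C)
          + ncycles C (Hilbert_Choice.inv (perm_restrict \<beta> C) \<circ> perm_restrict \<alpha> C) = card C + 1)"

lemma ncycles_less_if_refines:
  assumes r: "refines n \<gamma> \<alpha>" and ne: "\<gamma> \<noteq> \<alpha>"
  shows "ncycles {1..n} \<alpha> < ncycles {1..n} \<gamma>"
proof -
  let ?S = "{1..n}"
  from r have a: "\<alpha> permutes ?S" and g: "\<gamma> permutes ?S" by (auto simp: refines_def)
  have pa: "permutation \<alpha>" and pg: "permutation \<gamma>"
    using a g finite_atLeastAtMost permutation_permutes by blast+
  have step: "\<gamma> y \<in> Orbits.orbit \<alpha> x" if "x \<in> ?S" "y \<in> Orbits.orbit \<alpha> x" for x y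
  proof -
    have "perm_restrict \<gamma> (Orbits.orbit \<alpha> x) permutes Orbits.orbit \<alpha> x"
      using r that(1) by (auto simp: refines_def cycles_def)
    then show ?thesis using that(2) by (metis perm_restrict_simps(1) permutes_in_image)
  qed
  have sub: "y \<in> Orbits.orbit \<alpha> x" if "x \<in> ?S" "y \<in> Orbits.orbit \<gamma> x" for x y
    using that(2)
    by induct (auto intro: step that(1) permutation_self_in_orbit pa)
  have eqa: "Orbits.orbit \<alpha> y = Orbits.orbit \<alpha> x" if "y \<in> Orbits.orbit \<alpha> x" for x y
    using that cyclic_on_orbit'[OF pa, of x] unfolding cyclic_on_alldef by blast
  define h where "h D = Orbits.orbit \<alpha> (SOME x. x \<in> D)" for D :: "nat set"
  have h: "h (Orbits.orbit \<gamma> x) = Orbits.orbit \<alpha> x" if "x \<in> ?S" for x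
    unfolding h_def
    by (rule eqa, rule sub[OF that], rule someI, rule permutation_self_in_orbit[OF pg])
  have im: "cycles ?S \<alpha> = h ` cycles ?S \<gamma>"
    unfolding cycles_def image_image by (auto simp: h)
  have fin: "finite (cycles ?S \<gamma>)" by (simp add: cycles_def)
  have le: "ncycles ?S \<alpha> \<le> ncycles ?S \<gamma>"
    unfolding ncycles_def im by (rule card_image_le[OF fin])
  moreover have "ncycles ?S \<alpha> \<noteq> ncycles ?S \<gamma>"
  proof
    assume eq: "ncycles ?S \<alpha> = ncycles ?S \<gamma>"
    then have inj: "inj_on h (cycles ?S \<gamma>)"
      unfolding ncycles_def im by (intro eq_card_imp_inj_on fin)
    have "\<gamma> x = \<alpha> x" for x
    proof (cases "x \<in> ?S")
      case False
      then show ?thesis using a g by (metis permutes_not_in)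
    next
      case True
      define C where "C = Orbits.orbit \<alpha> x"
      have CS: "C \<subseteq> ?S" unfolding C_def by (rule permutes_orbit_subset[OF a True])
      have finC: "finite C" using CS finite_subset by blast
      have xC: "x \<in> C" unfolding C_def by (rule permutation_self_in_orbit[OF pa])
      let ?b = "perm_restrict \<gamma> C" and ?a = "perm_restrict \<alpha> C"
      have C: "?b permutes C" "ncycles C ?b + ncycles C (Hilbert_Choice.inv ?b \<circ> ?a) = card C + 1"
        using r True by (auto simp: refines_def cycles_def C_def)
      have orb: "Orbits.orbit ?b y = Orbits.orbit \<gamma> x" if "y \<in> C" for y
      proof -
        have yS: "y \<in> ?S" using that CS by blast
        have "h (Orbits.orbit \<gamma> y) = h (Orbits.orbit \<gamma> x)"
          using that h[OF yS] h[OF True] eqa[of y x] by (simp add: C_def)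
        then have 1: "Orbits.orbit \<gamma> y = Orbits.orbit \<gamma> x"
          using inj yS True by (auto simp: cycles_def dest: inj_onD)
        have 2: "z \<in> C" if "z \<in> Orbits.orbit \<gamma> y" for z
          using sub[OF yS that] eqa[of y x] \<open>y \<in> C\<close> by (simp add: C_def)
        have "Orbits.orbit ?b y = Orbits.orbit \<gamma> y"
          by (rule orbit_cong0[of _ C])
             (use that step[OF True] in \<open>auto simp: perm_restrict_simps C_def\<close>)
        with 1 show ?thesis by simp
      qed
      have "cycles C ?b = {Orbits.orbit \<gamma> x}"
        unfolding cycles_def using xC orb by auto
      then have n: "ncycles C (Hilbert_Choice.inv ?b \<circ> ?a) = card C"
        using C(2) by (simp add: ncycles_def)
      let ?d = "Hilbert_Choice.inv ?b \<circ> ?a"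
      have injd: "inj_on (Orbits.orbit ?d) C"
        using n unfolding ncycles_def cycles_def by (intro eq_card_imp_inj_on finC)
      have "?a permutes C"
      proof (rule bij_imp_permutes)
        have "inj_on ?a C" using permutes_inj_on[OF a, of C]
          by (auto simp: inj_on_def perm_restrict_simps)
        moreover have "?a ` C \<subseteq> C"
          by (auto simp: perm_restrict_simps C_def intro: orbit.step)
        ultimately show "bij_betw ?a C C"
          using finC by (simp add: bij_betw_def endo_inj_surj)
      qed (simp add: perm_restrict_simps)
      then have d: "?d permutes C" using C(1) by (intro permutes_compose permutes_inv)
      then have pd: "permutation ?d" using finC permutation_permutes by blast
      have "?d x \<in> C" using d xC by (simp only: permutes_in_image)
      moreover have "Orbits.orbit ?d (?d x) = Orbits.orbit ?d x"
        by (rule permutation_orbit_step[OF pd])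
      ultimately have "?d x = x" using injd xC by (auto dest: inj_onD)
      then have "?a x = ?b x"
        by (metis C(1) comp_apply permutes_inverses(1))
      then show ?thesis using xC by (simp add: perm_restrict_simps)
    qed
    then show False using ne by blast
  qed
  ultimately show ?thesis by simp
qed

text \<open>
  The Moebius function of the interval \<open>[\<beta>, \<alpha>]\<close>; the recursion extends it by \<open>0\<close> to pairs
  \<open>\<beta> \<noteq> \<alpha>\<close> with \<open>\<beta>\<close> not a refinement of \<open>\<alpha>\<close>. It terminates because a proper refinement
  has more cycles.
\<close>

function moebius :: "nat \<Rightarrow> (nat \<Rightarrow> nat) \<Rightarrow> (nat \<Rightarrow> nat) \<Rightarrow> int" where
  "moebius n \<beta> \<alpha> =
     (if \<beta> = \<alpha> then 1
      else if refines n \<beta> \<alpha> then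
        - (\<Sum>\<gamma> | refines n \<beta> \<gamma> \<and> refines n \<gamma> \<alpha> \<and> \<gamma> \<noteq> \<alpha>. moebius n \<beta> \<gamma>)
      else 0)"
  by auto
termination
proof (relation "Wellfounded.measure (\<lambda>(n, \<beta>, \<alpha>). n - ncycles {1..n} \<alpha>)", simp)
  fix n \<beta> \<alpha> \<gamma>
  assume "\<gamma> \<in> {\<gamma>. refines n \<beta> \<gamma> \<and> refines n \<gamma> \<alpha> \<and> \<gamma> \<noteq> \<alpha>}"
  then have "ncycles {1..n} \<alpha> < ncycles {1..n} \<gamma>"
    using ncycles_less_if_refines by blast
  moreover have "ncycles {1..n} \<gamma> \<le> n"
    unfolding ncycles_def cycles_def using card_image_le[of "{1..n}" "Orbits.orbit \<gamma>"] by simp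
  ultimately show "((n, \<beta>, \<gamma>), (n, \<beta>, \<alpha>)) \<in> Wellfounded.measure (\<lambda>(n, \<beta>, \<alpha>). n - ncycles {1..n} \<alpha>)"
    by simp
qed

declare moebius.simps [simp del]

text \<open>
  The subtraction of natural numbers in the exponent is never truncated: the exponent is the
  dimension of the cycle space of the bipartite multigraph whose vertices are the cycles of
  \<open>\<sigma>\<close> and the cycles of \<open>\<beta>\<close>, and in which each point of \<^term>\<open>{1..n}\<close> is an edge
  that joins the two cycles through it; its components correspond to the orbits counted by
  \<^term>\<open>nclasses n \<sigma> \<beta>\<close>.
\<close>

definition flow_polynomial :: "nat \<Rightarrow> (nat \<Rightarrow> nat) \<Rightarrow> (nat \<Rightarrow> nat) \<Rightarrow> int poly" where
  "flow_polynomial n \<sigma> \<alpha> =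
     (\<Sum>\<beta> | refines n \<beta> \<alpha>.
        monom (moebius n \<beta> \<alpha>)
          (n + nclasses n \<sigma> \<beta> - ncycles {1..n} \<beta> - ncycles {1..n} \<sigma>))"

text \<open>
  Functions on \<open>{1..n}\<close> are taken to be extensional, so that counting them as functions on
  \<^typ>\<open>nat\<close> is correct.
\<close>

definition flows :: "nat \<Rightarrow> (nat \<Rightarrow> nat) \<Rightarrow> (nat \<Rightarrow> nat) \<Rightarrow> (nat \<Rightarrow> 'k::field) set" where
  "flows n \<sigma> \<alpha> =
     {f \<in> {1..n} \<rightarrow>\<^sub>E UNIV. \<forall>C \<in> cycles {1..n} \<sigma> \<union> cycles {1..n} \<alpha>. (\<Sum>i\<in>C. f i) = 0}"

definition nowhere_zero_flows :: "nat \<Rightarrow> (nat \<Rightarrow> nat) \<Rightarrow> (nat \<Rightarrow> nat) \<Rightarrow> (nat \<Rightarrow> 'k::field) set" where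
  "nowhere_zero_flows n \<sigma> \<alpha> =
     {f \<in> flows n \<sigma> \<alpha>. \<forall>i\<in>{1..n}. f i = 0 \<longrightarrow> {i} \<in> cycles {1..n} \<alpha>}"

end

theory Submission
  imports Defs
begin

text \<open>
  Each flow \<open>f\<close> on \<open>(\<sigma>, \<alpha>)\<close> has a least refinement \<open>\<beta>\<^sub>f \<le> \<alpha>\<close> on which it is still a flow: a cycle
  of length three carries three values with sum zero, so it has no, exactly one or only zeros, and
  \<open>\<beta>\<^sub>f\<close> replaces it by itself, by the transposition of the two nonzero points, or by the identity.
  Thus \<open>f\<close> is a flow on \<open>(\<sigma>, \<beta>)\<close> iff \<open>\<beta>\<^sub>f \<le> \<beta>\<close>, and \<open>f\<close> is nowhere zero iff \<open>\<beta>\<^sub>f = \<alpha>\<close>. Since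
  \<open>(\<sigma>, \<beta>)\<close> has \<open>q\<^bsup>n + \<kappa>(\<sigma>, \<beta>) - z(\<beta>) - z(\<sigma>)\<^esup>\<close> flows, \<open>C(\<sigma>, \<alpha>; q)\<close> equals the sum over all flows \<open>f\<close>
  of \<open>\<Sum>\<beta>. \<mu>(\<beta>, \<alpha>)\<close> over \<open>\<beta>\<^sub>f \<le> \<beta> \<le> \<alpha>\<close>, which is \<open>1\<close> if \<open>\<beta>\<^sub>f = \<alpha>\<close> and \<open>0\<close> otherwise.
\<close>

section \<open>Counting flows\<close>

text \<open>Adding \<open>t / c i\<close> to the coordinate \<open>i\<close> raises the functional
  by \<open>t\<close>. Hence each vector arises from exactly one zero of the functional and one
  \<open>t\<close>, its value.\<close>

lemma card_zeros_linear_functional: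
  fixes c :: "'i \<Rightarrow> 'k::{field,finite}"
  assumes "finite I" "i \<in> I" "c i \<noteq> 0"
  shows "card {y \<in> I \<rightarrow>\<^sub>E UNIV. (\<Sum>i\<in>I. c i * y i) = 0} * CARD('k) = CARD('k) ^ card I"
proof -
  define L where "L y = (\<Sum>i\<in>I. c i * y i)" for y :: "'i \<Rightarrow> 'k"
  define Z where "Z = {y \<in> I \<rightarrow>\<^sub>E UNIV. L y = 0}"
  have upd: "L (y(i := y i + t)) = L y + c i * t" for y t
    unfolding L_def using assms(1,2) by (simp add: sum.remove distrib_left)
  have "bij_betw (\<lambda>(y, t). y(i := y i + t / c i)) (Z \<times> UNIV) (I \<rightarrow>\<^sub>E UNIV)"
  proof (rule bij_betw_byWitness[where f' = "\<lambda>y. (y(i := y i + (- L y / c i)), L y)"])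
    show "\<forall>a\<in>Z \<times> UNIV. (\<lambda>y. (y(i := y i + (- L y / c i)), L y))
        ((\<lambda>(y, t). y(i := y i + t / c i)) a) = a"
      using assms(3) by (auto simp: Z_def upd)
    show "\<forall>a\<in>I \<rightarrow>\<^sub>E UNIV. (\<lambda>(y, t). y(i := y i + t / c i))
        ((\<lambda>y. (y(i := y i + (- L y / c i)), L y)) a) = a"
      by auto
    show "(\<lambda>(y, t). y(i := y i + t / c i)) ` (Z \<times> UNIV) \<subseteq> I \<rightarrow>\<^sub>E UNIV"
      using assms(2) by (auto simp: Z_def PiE_iff extensional_def)
    show "(\<lambda>y. (y(i := y i + (- L y / c i)), L y)) ` (I \<rightarrow>\<^sub>E UNIV) \<subseteq> Z \<times> UNIV"
      using assms(2,3) by (auto simp only: Z_def upd) (auto simp: PiE_iff extensional_def)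
  qed
  then have "card (Z \<times> (UNIV :: 'k set)) = card (I \<rightarrow>\<^sub>E (UNIV :: 'k set))"
    by (rule bij_betw_same_card)
  then show ?thesis
    using assms(1) by (simp add: card_cartesian_product card_funcsetE Z_def L_def)
qed

text \<open>For fixed \<open>x\<close>, the admissible \<open>y\<close> form the whole space if
  \<open>x\<close> lies in the kernel of \<open>A\<close> and a hyperplane otherwise. After
  multiplication by \<open>CARD('k)\<close> both cases have the common term
  \<open>CARD('k) ^ card I\<close>, and only kernel vectors contribute more.\<close>

lemma card_orthogonal_pairs:
  fixes A :: "'i \<Rightarrow> 'j \<Rightarrow> 'k::{field,finite}"
  assumes "finite I" "finite J"
  defines "X \<equiv> J \<rightarrow>\<^sub>E (UNIV :: 'k set)" and "Y \<equiv> I \<rightarrow>\<^sub>E (UNIV :: 'k set)"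
  shows "card (SIGMA x:X. {y\<in>Y. (\<Sum>i\<in>I. (\<Sum>j\<in>J. A i j * x j) * y i) = 0}) * CARD('k)
    = CARD('k) ^ (card I + card J)
      + card {x\<in>X. \<forall>i\<in>I. (\<Sum>j\<in>J. A i j * x j) = 0} * CARD('k) ^ card I * (CARD('k) - 1)"
proof -
  let ?q = "CARD('k)"
  let ?N = "\<lambda>x. {y\<in>Y. (\<Sum>i\<in>I. (\<Sum>j\<in>J. A i j * x j) * y i) = 0}"
  let ?K = "{x\<in>X. \<forall>i\<in>I. (\<Sum>j\<in>J. A i j * x j) = 0}"
  have fin: "finite X" "finite Y"
    unfolding X_def Y_def using assms by (auto intro: finite_PiE)
  have q: "a * ?q = a + a * (?q - 1)" for a
    by (cases ?q) auto
  have "card (?N x) * ?q = ?q ^ card I + (if x \<in> ?K then ?q ^ card I * (?q - 1) else 0)"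
    if x: "x \<in> X" for x
  proof (cases "x \<in> ?K")
    case True
    then have "?N x = Y" by auto
    moreover have "card Y = ?q ^ card I" unfolding Y_def using assms by (simp add: card_funcsetE)
    ultimately show ?thesis using True q[of "?q ^ card I"] by simp
  next
    case False
    then obtain i where "i \<in> I" "(\<Sum>j\<in>J. A i j * x j) \<noteq> 0" using x by auto
    then show ?thesis
      using card_zeros_linear_functional[OF assms(1), of i "\<lambda>i. \<Sum>j\<in>J. A i j * x j"] False
      by (simp add: Y_def del: mem_Collect_eq)
  qed
  then have "(\<Sum>x\<in>X. card (?N x) * ?q)
      = (\<Sum>x\<in>X. ?q ^ card I + (if x \<in> ?K then ?q ^ card I * (?q - 1) else 0))"
    by (intro sum.cong) auto
  also have "\<dots> = card X * ?q ^ card I + card ?K * (?q ^ card I * (?q - 1))"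
  proof -
    have "{x \<in> X. x \<in> ?K} = ?K" by auto
    then show ?thesis
      using fin by (simp add: sum.distrib sum.If_cases Int_def)
  qed
  finally show ?thesis
    using fin assms(2) by (simp add: sum_distrib_left[symmetric] card_SigmaI X_def card_funcsetE power_add mult_ac)
qed

text \<open>
  A matrix and its transpose have the same rank. No rank is needed: the pairs \<open>(x, y)\<close> with
  \<open>y\<^sup>T A x = 0\<close> are counted once by fixing \<open>x\<close> and once by fixing \<open>y\<close>.
\<close>

lemma card_kernel_transpose:
  fixes A :: "'i \<Rightarrow> 'j \<Rightarrow> 'k::{field,finite}"
  assumes "finite I" "finite J"
  shows "card {x \<in> J \<rightarrow>\<^sub>E UNIV. \<forall>i\<in>I. (\<Sum>j\<in>J. A i j * x j) = 0} * CARD('k) ^ card I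
    = card {y \<in> I \<rightarrow>\<^sub>E UNIV. \<forall>j\<in>J. (\<Sum>i\<in>I. A i j * y i) = 0} * CARD('k) ^ card J"
proof -
  let ?X = "J \<rightarrow>\<^sub>E (UNIV :: 'k set)" and ?Y = "I \<rightarrow>\<^sub>E (UNIV :: 'k set)"
  let ?P = "SIGMA x:?X. {y\<in>?Y. (\<Sum>i\<in>I. (\<Sum>j\<in>J. A i j * x j) * y i) = 0}"
  let ?Q = "SIGMA y:?Y. {x\<in>?X. (\<Sum>j\<in>J. (\<Sum>i\<in>I. A i j * y i) * x j) = 0}"
  have eq: "(\<Sum>i\<in>I. (\<Sum>j\<in>J. A i j * x j) * y i) = (\<Sum>j\<in>J. (\<Sum>i\<in>I. A i j * y i) * x j)" for x y
    unfolding sum_distrib_right by (subst sum.swap) (simp add: mult_ac)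
  have "?Q = prod.swap ` ?P"
    by (auto simp: eq image_iff)
  then have "card ?Q = card ?P" by (simp add: card_image)
  then have "card {x\<in>?X. \<forall>i\<in>I. (\<Sum>j\<in>J. A i j * x j) = 0} * CARD('k) ^ card I * (CARD('k) - 1)
    = card {y\<in>?Y. \<forall>j\<in>J. (\<Sum>i\<in>I. A i j * y i) = 0} * CARD('k) ^ card J * (CARD('k) - 1)"
    using card_orthogonal_pairs[OF assms, of A] card_orthogonal_pairs[OF assms(2,1), of "\<lambda>j i. A i j"]
    by (simp add: add.commute)
  \<comment> \<open>A field contains 0 and 1, so the common factor can be cancelled.\<close>
  moreover have "CARD('k) - 1 \<noteq> 0"
    using card_mono[of "UNIV :: 'k set" "{0, 1}"] by simp
  ultimately show ?thesis by simp
qed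

section \<open>Functions constant on the orbits of the generated group\<close>

lemma in_generate_sym_group:
  assumes "\<sigma> permutes {1..n}" "\<beta> permutes {1..n}" "p \<in> generate (sym_group n) {\<sigma>, \<beta>}"
  shows "p permutes {1..n}"
  using group.generate_incl[OF sym_group_is_group, of "{\<sigma>, \<beta>}" n] assms
  by (auto simp: sym_group_carrier)

lemma generate_invariant:
  assumes "\<sigma> permutes {1..n}" "\<beta> permutes {1..n}"
    and "\<And>x. x \<in> {1..n} \<Longrightarrow> g (\<sigma> x) = g x" "\<And>x. x \<in> {1..n} \<Longrightarrow> g (\<beta> x) = g x"
    and "p \<in> generate (sym_group n) {\<sigma>, \<beta>}" "x \<in> {1..n}"
  shows "g (p x) = g x"
  using assms(5,6)
proof (induction arbitrary: x rule: generate.induct)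
  case one
  then show ?case by (simp add: sym_group_one)
next
  case (incl h)
  then show ?case using assms(3,4) by auto
next
  case (inv h)
  then have h: "h permutes {1..n}" and hx: "\<And>x. x \<in> {1..n} \<Longrightarrow> g (h x) = g x"
    using assms(1-4) by auto
  have "Hilbert_Choice.inv h x \<in> {1..n}"
    using permutes_in_image[OF permutes_inv[OF h]] inv.prems by blast
  from hx[OF this] show ?case
    using h by (simp add: sym_group_carrier permutes_inverses)
next
  case (eng h1 h2)
  have "h2 x \<in> {1..n}"
    using permutes_in_image[OF in_generate_sym_group[OF assms(1,2) eng.hyps(2)]] eng.prems by blast
  then show ?case using eng by (simp add: sym_group_mult)
qed

text \<open>Invariant functions are those that factor through the set of group orbits, so each orbit
  allows one free value. This is how \<open>nclasses\<close> enters the count of flows.\<close>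

lemma card_invariant_functions:
  assumes s: "\<sigma> permutes {1..n}" and b: "\<beta> permutes {1..n}"
  shows "card {g \<in> {1..n} \<rightarrow>\<^sub>E (UNIV :: 'k::finite set). \<forall>x\<in>{1..n}. g (\<sigma> x) = g x \<and> g (\<beta> x) = g x}
    = CARD('k) ^ nclasses n \<sigma> \<beta>"
proof -
  let ?S = "{1..n}" and ?G = "generate (sym_group n) {\<sigma>, \<beta>}"
  let ?I = "{g \<in> ?S \<rightarrow>\<^sub>E (UNIV :: 'k set). \<forall>x\<in>?S. g (\<sigma> x) = g x \<and> g (\<beta> x) = g x}"
  define cl where "cl x = {p x | p. p \<in> ?G}" for x
  have orbs: "orbits ((sym_group n)\<lparr>carrier := ?G\<rparr>) ?S (\<lambda>p. p) = cl ` ?S"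
    by (auto simp: orbits_def Group_Action.orbit_def cl_def)
  \<comment> \<open>Multiplying a group element on the right by \<open>h\<close>, or by its inverse,
    translates between images of \<open>h x\<close> and images of \<open>x\<close>.\<close>
  have step: "cl (h x) = cl x" if h: "h \<in> {\<sigma>, \<beta>}" for h x
  proof -
    have hp: "h permutes ?S" using that s b by auto
    have "\<exists>r\<in>?G. p (h x) = r x" if "p \<in> ?G" for p
      using generate.eng[OF that generate.incl[OF h]] by (auto simp: sym_group_mult intro!: bexI[of _ "p \<circ> h"])
    moreover have "\<exists>r\<in>?G. p x = r (h x)" if "p \<in> ?G" for p
      using generate.eng[OF that generate.inv[OF h]] hp
      by (auto simp: sym_group_mult sym_group_carrier permutes_inverses
          intro!: bexI[of _ "p \<circ> Hilbert_Choice.inv h"])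
    ultimately show ?thesis unfolding cl_def by blast
  qed
  have self: "x \<in> cl x" for x
    unfolding cl_def using generate.one[of "sym_group n" "{\<sigma>, \<beta>}"]
    by (auto simp: sym_group_one intro!: exI[of _ id])
  have const: "g y = g x" if "g \<in> ?I" "x \<in> ?S" "y \<in> cl x" for g x y
    using that generate_invariant[OF s b, of g] by (auto simp: cl_def)
  have "bij_betw (\<lambda>h. restrict (\<lambda>x. h (cl x)) ?S) (cl ` ?S \<rightarrow>\<^sub>E UNIV) ?I"
  proof (rule bij_betw_byWitness[where f' = "\<lambda>g. restrict (\<lambda>C. g (SOME x. x \<in> C)) (cl ` ?S)"])
    have "g (SOME y. y \<in> cl x) = g x" if "g \<in> ?I" "x \<in> ?S" for g x
      using const[OF that] someI[of "\<lambda>y. y \<in> cl x", OF self] by blast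
    then show "\<forall>g\<in>?I. restrict (\<lambda>x. restrict (\<lambda>C. g (SOME x. x \<in> C)) (cl ` ?S) (cl x)) ?S = g"
      by (auto simp: fun_eq_iff restrict_def PiE_iff extensional_def)
    have img: "\<sigma> x \<in> ?S" "\<beta> x \<in> ?S" if "x \<in> ?S" for x
      using that permutes_in_image[OF s] permutes_in_image[OF b] by blast+
    show sub: "(\<lambda>h. restrict (\<lambda>x. h (cl x)) ?S) ` (cl ` ?S \<rightarrow>\<^sub>E UNIV) \<subseteq> ?I"
      using img by (auto simp: step simp del: atLeastAtMost_iff)
    show "\<forall>h\<in>cl ` ?S \<rightarrow>\<^sub>E (UNIV :: 'k set). restrict (\<lambda>C. restrict (\<lambda>x. h (cl x)) ?S (SOME x. x \<in> C)) (cl ` ?S) = h"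
    proof
      fix h :: "nat set \<Rightarrow> 'k" assume h: "h \<in> cl ` ?S \<rightarrow>\<^sub>E UNIV"
      then have g: "restrict (\<lambda>x. h (cl x)) ?S \<in> ?I" using sub by blast
      have val: "restrict (\<lambda>x. h (cl x)) ?S (SOME y. y \<in> cl x) = h (cl x)" if "x \<in> ?S" for x
        using const[OF g that] someI[of "\<lambda>y. y \<in> cl x", OF self] that by (metis restrict_apply')
      have "h C = restrict (\<lambda>x. h (cl x)) ?S (SOME y. y \<in> C)" if "C \<in> cl ` ?S" for C
        using that by (elim imageE) (simp only: val)
      then show "restrict (\<lambda>C. restrict (\<lambda>x. h (cl x)) ?S (SOME x. x \<in> C)) (cl ` ?S) = h"
        using PiE_arb[OF h] by (intro ext) (metis restrict_apply)
    qed
    show "(\<lambda>g. restrict (\<lambda>C. g (SOME x. x \<in> C)) (cl ` ?S)) ` ?I \<subseteq> cl ` ?S \<rightarrow>\<^sub>E UNIV"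
      by auto
  qed
  then have "card ?I = card (cl ` ?S \<rightarrow>\<^sub>E (UNIV :: 'k set))"
    by (rule bij_betw_same_card[symmetric])
  then show ?thesis
    by (simp add: nclasses_def orbs card_funcsetE del: One_nat_def)
qed


section \<open>Flows as the kernel of the incidence matrix of cycles and points\<close>

lemma in_cycles_iff:
  assumes "finite S" "p permutes S" "x \<in> S" "C \<in> cycles S p"
  shows "x \<in> C \<longleftrightarrow> C = Orbits.orbit p x"
proof
  have p: "permutation p" using assms permutation_permutes by blast
  obtain y where y: "C = Orbits.orbit p y" using assms(4) by (auto simp: cycles_def)
  show "C = Orbits.orbit p x" if "x \<in> C"
    using that orbit_cyclic_eq3[OF cyclic_on_orbit'[OF p]] y by blast
  show "x \<in> C" if "C = Orbits.orbit p x"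
    using that permutation_self_in_orbit[OF p] by simp
qed

lemma cycles_subset:
  assumes "p permutes S" "C \<in> cycles S p"
  shows "C \<subseteq> S"
  using assms(2) permutes_orbit_subset[OF assms(1)] by (auto simp: cycles_def)

lemma finite_cycles: "finite S \<Longrightarrow> finite (cycles S p)"
  by (simp add: cycles_def)

lemma orbit_in_cycles: "x \<in> S \<Longrightarrow> Orbits.orbit p x \<in> cycles S p"
  by (simp add: cycles_def)

lemma invariant_on_orbit:
  assumes "p permutes S" "\<And>x. x \<in> S \<Longrightarrow> g (p x) = g x" "x \<in> S" "y \<in> Orbits.orbit p x"
  shows "g y = g x"
  using assms(4)
proof induction
  case base
  then show ?case using assms by simp
next
  case (step y)
  then show ?case using assms permutes_orbit_subset[OF assms(1,3)] by auto
qed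

text \<open>
  The functions counted here form the left kernel of the incidence matrix whose right kernel is the
  space of flows.
\<close>

lemma card_potentials:
  assumes s: "\<sigma> permutes {1..n}" and b: "\<beta> permutes {1..n}"
  shows "card {y \<in> cycles {1..n} \<sigma> <+> cycles {1..n} \<beta> \<rightarrow>\<^sub>E (UNIV :: 'k::{field,finite} set).
      \<forall>j\<in>{1..n}. y (Inl (Orbits.orbit \<sigma> j)) + y (Inr (Orbits.orbit \<beta> j)) = 0}
    = CARD('k) ^ nclasses n \<sigma> \<beta>"
    (is "card ?Y = _")
proof -
  let ?S = "{1..n}" and ?V = "cycles {1..n} \<sigma> <+> cycles {1..n} \<beta>"
  let ?I = "{g \<in> ?S \<rightarrow>\<^sub>E (UNIV :: 'k set). \<forall>x\<in>?S. g (\<sigma> x) = g x \<and> g (\<beta> x) = g x}"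
  let ?f = "\<lambda>y. restrict (\<lambda>j. y (Inl (Orbits.orbit \<sigma> j))) ?S :: nat \<Rightarrow> 'k"
  have ps: "permutation \<sigma>" and pb: "permutation \<beta>"
    using s b finite_atLeastAtMost permutation_permutes by blast+
  have img: "\<sigma> x \<in> ?S" "\<beta> x \<in> ?S" if "x \<in> ?S" for x
    using that permutes_in_image[OF s] permutes_in_image[OF b] by blast+
  have neg: "y (Inl (Orbits.orbit \<sigma> j)) = - y (Inr (Orbits.orbit \<beta> j))"
    if "y \<in> ?Y" "j \<in> ?S" for y j
    using that by (simp add: eq_neg_iff_add_eq_0)
  \<comment> \<open>The values on the cycles of \<open>\<sigma>\<close> determine \<open>y\<close>,
    because the equation at \<open>j\<close> makes the value on the \<open>\<beta>\<close>-cycle of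
    \<open>j\<close> their negative. The same equation makes \<open>?f y\<close> constant along
    \<open>\<beta>\<close> as well as along \<open>\<sigma>\<close>.\<close>
  have "bij_betw ?f ?Y ?I"
    unfolding bij_betw_def
  proof
    show "inj_on ?f ?Y"
    proof (rule inj_onI)
      fix y z assume yz: "y \<in> ?Y" "z \<in> ?Y" "?f y = ?f z"
      have l: "y (Inl (Orbits.orbit \<sigma> j)) = z (Inl (Orbits.orbit \<sigma> j))" if "j \<in> ?S" for j
        using fun_cong[OF yz(3), of j] that by simp
      then have "y (Inr (Orbits.orbit \<beta> j)) = z (Inr (Orbits.orbit \<beta> j))" if "j \<in> ?S" for j
        using neg[OF yz(1) that] neg[OF yz(2) that] that by simp
      with l have "y i = z i" if "i \<in> ?V" for i
        using that by (auto simp only: cycles_def elim!: PlusE)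
      then show "y = z"
        using yz(1,2) by (intro PiE_ext[of y ?V "\<lambda>_. UNIV" z]) auto
    qed
    show "?f ` ?Y = ?I"
    proof
      have "?f y \<in> ?I" if y: "y \<in> ?Y" for y
        using img neg[OF y] permutation_orbit_step[OF ps] permutation_orbit_step[OF pb]
        by (simp del: atLeastAtMost_iff)
      then show "?f ` ?Y \<subseteq> ?I" by blast
      show "?I \<subseteq> ?f ` ?Y"
      proof
        fix g assume g: "g \<in> ?I"
        let ?h = "\<lambda>C. g (SOME x. x \<in> C)"
        let ?y = "restrict (case_sum ?h (\<lambda>C. - ?h C)) ?V"
        have h: "?h (Orbits.orbit p x) = g x" if "p \<in> {\<sigma>, \<beta>}" "x \<in> ?S" for p x
        proof (rule invariant_on_orbit[where g = g])
          show "p permutes ?S" using that s b by auto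
          show "g (p x) = g x" if "x \<in> ?S" for x
            using g that \<open>p \<in> {\<sigma>, \<beta>}\<close> by auto
          show "x \<in> ?S" by fact
          show "(SOME y. y \<in> Orbits.orbit p x) \<in> Orbits.orbit p x"
            by (rule someI) (rule orbit.base)
        qed
        have "?y \<in> ?Y"
          using h by (auto simp: orbit_in_cycles simp del: atLeastAtMost_iff)
        moreover have "g = ?f ?y"
          using g h by (intro PiE_ext[of g ?S "\<lambda>_. UNIV"])
            (auto simp: orbit_in_cycles simp del: atLeastAtMost_iff)
        ultimately show "g \<in> ?f ` ?Y" by blast
      qed
    qed
  qed
  then show ?thesis
    using card_invariant_functions[OF s b] by (simp only: bij_betw_same_card)
qed

lemma card_flows_mult:
  assumes s: "\<sigma> permutes {1..n}" and b: "\<beta> permutes {1..n}"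
  shows "card (flows n \<sigma> \<beta> :: (nat \<Rightarrow> 'k::{field,finite}) set)
      * CARD('k) ^ (ncycles {1..n} \<sigma> + ncycles {1..n} \<beta>)
    = CARD('k) ^ (nclasses n \<sigma> \<beta> + n)"
proof -
  let ?S = "{1..n}"
  \<comment> \<open>The union is disjoint because a set that is a cycle of both permutations must
    give two rows. \<open>A\<close> is the incidence matrix of cycles and points: its right kernel
    consists of the flows, its left kernel of the functions counted in
    \<open>card_potentials\<close>.\<close>
  let ?V = "cycles ?S \<sigma> <+> cycles ?S \<beta>"
  define A :: "nat set + nat set \<Rightarrow> nat \<Rightarrow> 'k" where
    "A v j = of_bool (j \<in> (case v of Inl C \<Rightarrow> C | Inr C \<Rightarrow> C))" for v j
  have fin: "finite ?V" "finite ?S" by (auto simp: finite_cycles)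
  have row: "(\<Sum>j\<in>?S. A (Inl C) j * x j) = sum x C" "(\<Sum>j\<in>?S. A (Inr C) j * x j) = sum x C"
    if "C \<subseteq> ?S" for C x
  proof -
    have "(\<Sum>j\<in>?S. of_bool (j \<in> C) * x j) = (\<Sum>j\<in>?S. if j \<in> C then x j else 0)"
      by (intro sum.cong) auto
    also have "\<dots> = sum x C"
      using that by (simp only: flip: sum.inter_restrict[OF fin(2)]) (simp add: Int_absorb1)
    finally show "(\<Sum>j\<in>?S. A (Inl C) j * x j) = sum x C" "(\<Sum>j\<in>?S. A (Inr C) j * x j) = sum x C"
      by (simp_all add: A_def)
  qed
  have "flows n \<sigma> \<beta> = {x \<in> ?S \<rightarrow>\<^sub>E UNIV. \<forall>v\<in>?V. (\<Sum>j\<in>?S. A v j * x j) = 0}"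
    unfolding flows_def Plus_def ball_Un ball_simps
    by (simp only: row cycles_subset[OF s] cycles_subset[OF b] cong: ball_cong)
  moreover have col: "(\<Sum>v\<in>?V. A v j * y v) = y (Inl (Orbits.orbit \<sigma> j)) + y (Inr (Orbits.orbit \<beta> j))"
    if j: "j \<in> ?S" for j y
  proof -
    have "(\<Sum>C\<in>cycles ?S \<sigma>. A (Inl C) j * y (Inl C))
        = (\<Sum>C\<in>cycles ?S \<sigma>. if C = Orbits.orbit \<sigma> j then y (Inl C) else 0)"
      using in_cycles_iff[OF fin(2) s j] by (intro sum.cong) (auto simp: A_def)
    moreover have "(\<Sum>C\<in>cycles ?S \<beta>. A (Inr C) j * y (Inr C))
        = (\<Sum>C\<in>cycles ?S \<beta>. if C = Orbits.orbit \<beta> j then y (Inr C) else 0)"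
      using in_cycles_iff[OF fin(2) b j] by (intro sum.cong) (auto simp: A_def)
    ultimately show ?thesis
      using j by (simp add: sum.Plus finite_cycles orbit_in_cycles del: atLeastAtMost_iff)
  qed
  have "{y \<in> ?V \<rightarrow>\<^sub>E UNIV. \<forall>j\<in>?S. (\<Sum>v\<in>?V. A v j * y v) = 0} = {y \<in> ?V \<rightarrow>\<^sub>E UNIV.
      \<forall>j\<in>?S. y (Inl (Orbits.orbit \<sigma> j)) + y (Inr (Orbits.orbit \<beta> j)) = 0}"
    by (simp only: col cong: ball_cong)
  moreover have "card ?V = ncycles ?S \<sigma> + ncycles ?S \<beta>"
    by (simp add: card_Plus finite_cycles ncycles_def)
  ultimately show ?thesis
    using card_kernel_transpose[OF fin, of A] card_potentials[OF s b, where 'k = 'k]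
    by (simp add: power_add)
qed

lemma card_flows:
  assumes s: "\<sigma> permutes {1..n}" and b: "\<beta> permutes {1..n}"
  shows "card (flows n \<sigma> \<beta> :: (nat \<Rightarrow> 'k::{field,finite}) set)
    = CARD('k) ^ (n + nclasses n \<sigma> \<beta> - ncycles {1..n} \<beta> - ncycles {1..n} \<sigma>)"
proof -
  let ?q = "CARD('k)" and ?z = "ncycles {1..n} \<sigma> + ncycles {1..n} \<beta>"
  let ?c = "card (flows n \<sigma> \<beta> :: (nat \<Rightarrow> 'k) set)"
  have q: "?q > 1"
    using card_mono[of "UNIV :: 'k set" "{0, 1}"] by simp
  note eq = card_flows_mult[OF s b, where 'k = 'k]
  \<comment> \<open>The product is a power of \<open>?q\<close>, so \<open>?c\<close> is at least 1.
    Comparing the powers then gives \<open>le\<close>, which says that the subtraction in the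
    exponent is not truncated.\<close>
  have "?c * ?q ^ ?z \<noteq> 0" using eq q by simp
  then have "?c \<ge> 1" by (cases ?c) auto
  then have "1 * ?q ^ ?z \<le> ?c * ?q ^ ?z" by (rule mult_le_mono1)
  then have "?q ^ ?z \<le> ?q ^ (nclasses n \<sigma> \<beta> + n)" using eq by (simp only: eq mult_1)
  then have le: "?z \<le> nclasses n \<sigma> \<beta> + n" using q by (simp only: power_le_imp_le_exp)
  then have "?c * ?q ^ ?z = ?q ^ (nclasses n \<sigma> \<beta> + n - ?z) * ?q ^ ?z"
    using eq by (simp only: flip: power_add) simp
  then have "?c = ?q ^ (nclasses n \<sigma> \<beta> + n - ?z)"
    using q by simp
  then show ?thesis by (simp add: add.commute diff_diff_add)
qed

section \<open>Refinement of permutations with small cycles\<close>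

text \<open>Four successive iterates cannot be distinct in an orbit of at most three points, and by
  injectivity any coincidence among them leads back to \<open>x\<close>. The set on the right has
  repetitions if the cycle is shorter than three.\<close>

lemma orbit_small:
  assumes p: "permutation p" and c: "card (Orbits.orbit p x) \<le> 3"
  shows "p (p x) = x \<or> p (p (p x)) = x" "Orbits.orbit p x = {x, p x, p (p x)}"
proof -
  have self: "x \<in> Orbits.orbit p x" by (rule permutation_self_in_orbit[OF p])
  have inj: "p u = p v \<longleftrightarrow> u = v" for u v
    using permutation_bijective[OF p] by (auto simp: bij_def inj_def)
  have sub: "{x, p x, p (p x), p (p (p x))} \<subseteq> Orbits.orbit p x"
    using self by (auto intro: orbit.intros)
  then have "card {x, p x, p (p x), p (p (p x))} \<le> 3"
    using card_mono[OF finite_orbit[OF self] sub] c by simp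
  then show ret: "p (p x) = x \<or> p (p (p x)) = x"
    by (auto simp: card_insert_if inj split: if_splits)
  have "y \<in> {x, p x, p (p x)}" if "y \<in> Orbits.orbit p x" for y
    using that by induction (use ret in auto)
  with sub show "Orbits.orbit p x = {x, p x, p (p x)}" by auto
qed

text \<open>Two nontrivial cycles would need four points, so all moved points lie on one cycle. The
  genus condition thereby becomes a count of fixed points.\<close>

lemma ncycles_small:
  assumes fin: "finite C" and p: "p permutes C" and c: "card C \<le> 3"
  shows "ncycles C p = card {y\<in>C. p y = y} + of_bool (\<exists>y\<in>C. p y \<noteq> y)"
proof -
  let ?F = "{y\<in>C. p y = y}" and ?M = "{y\<in>C. p y \<noteq> y}"
  have pp: "permutation p" using fin p permutation_permutes by blast
  have inj: "p u = p v \<longleftrightarrow> u = v" for u v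
    using permutation_bijective[OF pp] by (auto simp: bij_def inj_def)
  have self: "x \<in> Orbits.orbit p x" for x by (rule permutation_self_in_orbit[OF pp])
  have same: "Orbits.orbit p x = Orbits.orbit p y" if "x \<in> ?M" "y \<in> ?M" for x y
  proof (rule ccontr)
    assume ne: "Orbits.orbit p x \<noteq> Orbits.orbit p y"
    have "Orbits.orbit p z = Orbits.orbit p x" if "z \<in> Orbits.orbit p x" for z
      by (rule orbit_cyclic_eq3[OF cyclic_on_orbit'[OF pp] that])
    from this[of y] this[of "p y"] have "y \<notin> Orbits.orbit p x" "p y \<notin> Orbits.orbit p x"
      using ne permutation_orbit_step[OF pp, of y] by auto
    moreover have "p x \<in> Orbits.orbit p x" by (rule orbit.base)
    ultimately have "card {x, p x, y, p y} = 4"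
      using that self[of x] by (auto simp: card_insert_if inj)
    moreover have "{x, p x, y, p y} \<subseteq> C" using that permutes_in_image[OF p] by auto
    ultimately show False using card_mono[OF fin, of "{x, p x, y, p y}"] c by simp
  qed
  have "cycles C p = Orbits.orbit p ` ?F \<union> Orbits.orbit p ` ?M"
    unfolding cycles_def by (subst image_Un[symmetric]) (rule arg_cong[of _ _ "image _"], auto)
  also have "Orbits.orbit p ` ?F = (\<lambda>y. {y}) ` ?F"
    by (intro image_cong) (auto simp: orbit_eq_singleton_iff)
  finally have "cycles C p = (\<lambda>y. {y}) ` ?F \<union> Orbits.orbit p ` ?M" .
  moreover have "(\<lambda>y. {y}) ` ?F \<inter> Orbits.orbit p ` ?M = {}"
    using orbit_eq_singleton_iff[of p] self by auto (metis singletonD)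
  ultimately have "ncycles C p = card ?F + card (Orbits.orbit p ` ?M)"
    using fin by (simp add: ncycles_def card_Un_disjoint card_image)
  moreover have "card (Orbits.orbit p ` ?M) = of_bool (?M \<noteq> {})"
  proof (cases "?M = {}")
    case True
    then show ?thesis by (simp only: image_empty card.empty) simp
  next
    case False
    then obtain x where "x \<in> ?M" by blast
    then have "Orbits.orbit p ` ?M = {Orbits.orbit p x}" using same by blast
    then show ?thesis using False by simp
  qed
  ultimately show ?thesis by (simp add: Bex_def)
qed

text \<open>
  On a cycle of \<open>\<alpha>\<close> with at most three points, the genus condition excludes only the inverse of a
  three-cycle, and this condition holds at every point for all other permutations of the cycle.
\<close>

definition refines_at :: "('a \<Rightarrow> 'a) \<Rightarrow> ('a \<Rightarrow> 'a) \<Rightarrow> 'a \<Rightarrow> bool" where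
  "refines_at \<beta> \<alpha> x \<longleftrightarrow> \<beta> x = x \<or> \<beta> x = \<alpha> x \<or> \<alpha> (\<beta> x) = x \<and> \<beta> (\<beta> x) = x"

text \<open>The pointwise form reduces transitivity to the alternatives at the two points
  \<open>x\<close> and \<open>\<gamma> x\<close>.\<close>

lemma refines_at_trans:
  assumes "inj \<gamma>" "\<And>y. refines_at \<gamma> \<beta> y" "\<And>y. refines_at \<beta> \<alpha> y"
  shows "refines_at \<gamma> \<alpha> x"
  using assms(2)[of x] assms(2)[of "\<gamma> x"] assms(3)[of x] assms(3)[of "\<gamma> x"] assms(1)
  unfolding refines_at_def inj_def by metis

text \<open>A fixed point of the quotient is a point where \<open>b\<close> and \<open>a\<close>
  agree, so \<open>ncycles_small\<close> turns the left side into a condition on the values of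
  \<open>b\<close>. The permutations of a cycle of length one, two or three are then checked one by
  one.\<close>

lemma genus_zero_iff_refines_at:
  assumes a: "a permutes C" and b: "b permutes C" and C: "C = {x, a x, a (a x)}"
    and ret: "a (a x) = x \<or> a (a (a x)) = x"
  shows "ncycles C b + ncycles C (Hilbert_Choice.inv b \<circ> a) = card C + 1
    \<longleftrightarrow> (\<forall>y\<in>C. refines_at b a y)"
proof -
  let ?d = "Hilbert_Choice.inv b \<circ> a"
  have fin: "finite C" using C by simp
  have c: "card C \<le> 3" unfolding C by (simp add: card_insert_if)
  have d: "?d permutes C" using a b by (intro permutes_compose permutes_inv)
  have fixes_iff: "?d y = y \<longleftrightarrow> b y = a y" for y
    using permutes_inverses[OF b] by (metis comp_apply)
  have cnt: "card {y\<in>C. P y} = (\<Sum>y\<in>C. of_bool (P y))" for P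
    using fin by (simp add: Int_def)
  have bC: "b y \<in> C" if "y \<in> C" for y using that permutes_in_image[OF b] by blast
  have injb: "b u = b v \<longleftrightarrow> u = v" for u v using permutes_inj[OF b] by (auto simp: inj_def)
  have inja: "a u = a v \<longleftrightarrow> u = v" for u v using permutes_inj[OF a] by (auto simp: inj_def)
  have iff: "ncycles C b + ncycles C ?d = card C + 1 \<longleftrightarrow>
      (\<Sum>y\<in>C. of_bool (b y = y)) + of_bool (\<exists>y\<in>C. b y \<noteq> y)
      + (\<Sum>y\<in>C. of_bool (b y = a y)) + of_bool (\<exists>y\<in>C. b y \<noteq> a y) = card C + 1"
    by (simp only: ncycles_small[OF fin b c] ncycles_small[OF fin d c] fixes_iff cnt add.assoc)
  consider "a x = x" | "a x \<noteq> x" "a (a x) = x"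
    | "a x \<noteq> x" "a (a x) \<noteq> x" "a (a (a x)) = x" using ret by auto
  then show ?thesis
  proof cases
    case 1
    then have "C = {x}" using C by simp
    then show ?thesis using bC[of x] 1 unfolding iff by (simp add: refines_at_def)
  next
    case 2
    then have C: "C = {x, a x}" using C by auto
    have "b x \<in> {x, a x}" "b (a x) \<in> {x, a x}" "b x \<noteq> b (a x)"
      using bC[of x] bC[of "a x"] injb[of x "a x"] 2(1) unfolding C by simp_all
    then show ?thesis
      using 2 unfolding iff unfolding C
      by (elim insertE emptyE) (simp_all add: refines_at_def)
  next
    case 3
    define y where "y = a x"
    define z where "z = a y"
    have C: "C = {x, y, z}" using C by (simp add: y_def z_def)
    have ne: "x \<noteq> y" "x \<noteq> z" "y \<noteq> z" and v: "a x = y" "a y = z" "a z = x"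
      using 3 by (auto simp: y_def z_def inja)
    have "b x \<in> {x, y, z}" "b y \<in> {x, y, z}" "b z \<in> {x, y, z}"
      using bC[of x] bC[of y] bC[of z] unfolding C by simp_all
    moreover have "b x \<noteq> b y" "b x \<noteq> b z" "b y \<noteq> b z"
      using ne by (simp_all add: injb)
    ultimately show ?thesis
      using ne unfolding iff unfolding C
      by (elim insertE emptyE) (simp_all add: refines_at_def v)
  qed
qed

lemma refines_cycle_iff:
  assumes a: "permutation \<alpha>" and c: "card (Orbits.orbit \<alpha> x) \<le> 3" and b: "inj \<beta>"
  defines "C \<equiv> Orbits.orbit \<alpha> x"
  shows "perm_restrict \<beta> C permutes C \<and>
      ncycles C (perm_restrict \<beta> C)
        + ncycles C (Hilbert_Choice.inv (perm_restrict \<beta> C) \<circ> perm_restrict \<alpha> C) = card C + 1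
    \<longleftrightarrow> (\<forall>y\<in>C. refines_at \<beta> \<alpha> y)"
proof -
  note C = orbit_small(2)[OF a c, folded C_def]
  have fin: "finite C" using C by simp
  have inja: "\<alpha> u = \<alpha> v \<longleftrightarrow> u = v" for u v
    using permutation_bijective[OF a] by (auto simp: bij_def inj_def)
  have aC: "\<alpha> y \<in> C \<longleftrightarrow> y \<in> C" for y
    using orbit_small(1)[OF a c] inja unfolding C by auto
  have permI: "perm_restrict p C permutes C" if "inj p" "\<And>y. y \<in> C \<Longrightarrow> p y \<in> C" for p
  proof (rule bij_imp_permutes)
    have "inj_on (perm_restrict p C) C"
      using that(1) by (auto simp: inj_on_def inj_def perm_restrict_simps)
    moreover have "perm_restrict p C ` C \<subseteq> C" using that(2) by (auto simp: perm_restrict_simps)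
    ultimately show "bij_betw (perm_restrict p C) C C"
      using fin by (simp add: bij_betw_def endo_inj_surj)
  qed (simp add: perm_restrict_simps)
  have pa: "perm_restrict \<alpha> C permutes C"
    using permI[of \<alpha>] inja aC by (auto simp: inj_def)
  have mem: "\<beta> y \<in> C" if "perm_restrict \<beta> C permutes C" "y \<in> C" for y
    using permutes_in_image[OF that(1), of y] that(2) by (simp add: perm_restrict_simps)
  \<comment> \<open>Each alternative makes \<open>\<beta> y\<close> equal to \<open>y\<close>, to
    \<open>\<alpha> y\<close> or to the \<open>\<alpha>\<close>-preimage of \<open>y\<close>, all of
    which lie in \<open>C\<close>.\<close>
  have pb: "perm_restrict \<beta> C permutes C" if "\<forall>y\<in>C. refines_at \<beta> \<alpha> y"
    using that aC by (intro permI[OF b]) (metis refines_at_def)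
  have C': "C = {x, perm_restrict \<alpha> C x, perm_restrict \<alpha> C (perm_restrict \<alpha> C x)}"
    "perm_restrict \<alpha> C (perm_restrict \<alpha> C x) = x \<or>
      perm_restrict \<alpha> C (perm_restrict \<alpha> C (perm_restrict \<alpha> C x)) = x"
    using C orbit_small(1)[OF a c] by (auto simp: perm_restrict_def)
  show ?thesis
  proof (cases "perm_restrict \<beta> C permutes C")
    case True
    have "(\<forall>y\<in>C. refines_at (perm_restrict \<beta> C) (perm_restrict \<alpha> C) y)
        \<longleftrightarrow> (\<forall>y\<in>C. refines_at \<beta> \<alpha> y)"
      using mem[OF True] by (simp add: refines_at_def perm_restrict_simps)
    then show ?thesis using genus_zero_iff_refines_at[OF pa True C'] True by simp
  next
    case False
    then show ?thesis using pb by blast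
  qed
qed

abbreviation small_cycles :: "nat \<Rightarrow> (nat \<Rightarrow> nat) \<Rightarrow> bool" where
  "small_cycles n \<alpha> \<equiv> (\<forall>C\<in>cycles {1..n} \<alpha>. card C \<le> 3)"

lemma permutes_imp_permutation: "p permutes {1..n::nat} \<Longrightarrow> permutation p"
  using finite_atLeastAtMost permutation_permutes by blast

lemma refines_iff_refines_at:
  assumes a: "\<alpha> permutes {1..n}" and small: "small_cycles n \<alpha>"
  shows "refines n \<beta> \<alpha> \<longleftrightarrow> \<beta> permutes {1..n} \<and> (\<forall>x. refines_at \<beta> \<alpha> x)"
proof (cases "\<beta> permutes {1..n}")
  case b: True
  note pa = permutes_imp_permutation[OF a]
  have iff: "perm_restrict \<beta> C permutes C \<and>
      ncycles C (perm_restrict \<beta> C)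
        + ncycles C (Hilbert_Choice.inv (perm_restrict \<beta> C) \<circ> perm_restrict \<alpha> C) = card C + 1
    \<longleftrightarrow> (\<forall>y\<in>C. refines_at \<beta> \<alpha> y)" if "C \<in> cycles {1..n} \<alpha>" for C
  proof -
    from that obtain x where C: "C = Orbits.orbit \<alpha> x" by (auto simp: cycles_def)
    have "card (Orbits.orbit \<alpha> x) \<le> 3" using small that C by blast
    from refines_cycle_iff[OF pa this permutes_inj[OF b]] show ?thesis unfolding C .
  qed
  have "refines n \<beta> \<alpha> \<longleftrightarrow> (\<forall>C\<in>cycles {1..n} \<alpha>. \<forall>y\<in>C. refines_at \<beta> \<alpha> y)"
    unfolding refines_def using a b iff by blast
  also have "\<dots> \<longleftrightarrow> (\<forall>x\<in>{1..n}. refines_at \<beta> \<alpha> x)"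
    unfolding cycles_def using permutes_orbit_subset[OF a] permutation_self_in_orbit[OF pa]
    by blast
  also have "\<dots> \<longleftrightarrow> (\<forall>x. refines_at \<beta> \<alpha> x)"
    using permutes_not_in[OF b] unfolding refines_at_def by blast
  finally show ?thesis using b by blast
qed (simp add: refines_def)

lemma refines_permutes:
  assumes "refines n \<beta> \<alpha>"
  shows "\<beta> permutes {1..n}" "\<alpha> permutes {1..n}"
  using assms by (auto simp: refines_def)

lemma orbit_subset_if_refines:
  assumes r: "refines n \<beta> \<alpha>" and x: "x \<in> {1..n}"
  shows "Orbits.orbit \<beta> x \<subseteq> Orbits.orbit \<alpha> x"
proof
  let ?C = "Orbits.orbit \<alpha> x"
  have C: "perm_restrict \<beta> ?C permutes ?C"
    using r x by (auto simp: refines_def cycles_def)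
  have step: "\<beta> y \<in> ?C" if "y \<in> ?C" for y
    using permutes_in_image[OF C, of y] that by (simp add: perm_restrict_simps)
  show "y \<in> ?C" if "y \<in> Orbits.orbit \<beta> x" for y
    using that
  proof induction
    case base
    show ?case
      by (intro step permutation_self_in_orbit permutes_imp_permutation[OF refines_permutes(2)[OF r]])
  qed (rule step)
qed

text \<open>Cycles of \<open>\<beta>\<close> lie inside cycles of \<open>\<alpha>\<close>. Thus the
  pointwise criterion also applies to refinements of a refinement of
  \<open>\<alpha>\<close>.\<close>

lemma small_cycles_if_refines:
  assumes r: "refines n \<beta> \<alpha>" and "small_cycles n \<alpha>"
  shows "small_cycles n \<beta>"
proof
  fix C assume "C \<in> cycles {1..n} \<beta>"
  then obtain x where x: "x \<in> {1..n}" "C = Orbits.orbit \<beta> x" by (auto simp: cycles_def)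
  have "finite (Orbits.orbit \<alpha> x)"
    using finite_subset[OF permutes_orbit_subset[OF refines_permutes(2)[OF r] x(1)]] by simp
  then have "card C \<le> card (Orbits.orbit \<alpha> x)"
    unfolding x(2) by (rule card_mono[OF _ orbit_subset_if_refines[OF r x(1)]])
  also have "\<dots> \<le> 3" using assms(2) x(1) by (auto simp: cycles_def)
  finally show "card C \<le> 3" .
qed

lemma refines_refl:
  assumes "\<alpha> permutes {1..n}" "small_cycles n \<alpha>"
  shows "refines n \<alpha> \<alpha>"
  using assms refines_iff_refines_at by (auto simp: refines_at_def)

lemma refines_trans:
  assumes g: "refines n \<gamma> \<beta>" and b: "refines n \<beta> \<alpha>" and small: "small_cycles n \<alpha>"
  shows "refines n \<gamma> \<alpha>"
proof -
  note p = refines_permutes[OF g] refines_permutes[OF b]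
  note sb = small_cycles_if_refines[OF b small]
  have "\<And>x. refines_at \<gamma> \<beta> x" "\<And>x. refines_at \<beta> \<alpha> x"
    using g b refines_iff_refines_at[OF p(2) sb] refines_iff_refines_at[OF p(4) small] by auto
  then show ?thesis
    using p refines_iff_refines_at[OF p(4) small] refines_at_trans[OF permutes_inj[OF p(1)]] by blast
qed

section \<open>Moebius inversion\<close>

lemma finite_refinements: "finite {\<beta>. refines n \<beta> \<alpha> \<and> P \<beta>}"
  by (rule finite_subset[OF _ finite_permutations[of "{1..n}"]]) (auto simp: refines_def)

lemma sum_moebius_lower:
  assumes r: "refines n \<beta> \<alpha>" and refl: "refines n \<alpha> \<alpha>"
  shows "(\<Sum>\<gamma> | refines n \<beta> \<gamma> \<and> refines n \<gamma> \<alpha>. moebius n \<beta> \<gamma>) = of_bool (\<beta> = \<alpha>)"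
proof (cases "\<beta> = \<alpha>")
  case True
  \<comment> \<open>Antisymmetry: a proper refinement has strictly more cycles.\<close>
  have "{\<gamma>. refines n \<alpha> \<gamma> \<and> refines n \<gamma> \<alpha>} = {\<alpha>}"
    using refl ncycles_less_if_refines by (auto dest: ncycles_less_if_refines) (metis less_asym)
  then show ?thesis using True by (simp add: moebius.simps)
next
  case False
  have "{\<gamma>. refines n \<beta> \<gamma> \<and> refines n \<gamma> \<alpha>}
      = insert \<alpha> {\<gamma>. refines n \<beta> \<gamma> \<and> refines n \<gamma> \<alpha> \<and> \<gamma> \<noteq> \<alpha>}"
    using r refl by auto
  moreover have "finite {\<gamma>. refines n \<beta> \<gamma> \<and> refines n \<gamma> \<alpha> \<and> \<gamma> \<noteq> \<alpha>}"
    using finite_refinements[of n \<alpha> "\<lambda>\<gamma>. refines n \<beta> \<gamma> \<and> \<gamma> \<noteq> \<alpha>"] by (simp add: conj_ac)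
  ultimately show ?thesis
    using False r by (simp add: moebius.simps[of n \<beta> \<alpha>])
qed

text \<open>
  The recursion for \<open>\<mu>\<close> says \<open>\<mu> * \<zeta> = \<delta>\<close>. For \<open>T = \<zeta> * \<mu>\<close> this gives \<open>T * \<zeta> = \<zeta>\<close>, and since \<open>\<zeta>\<close> is
  unitriangular, induction on the upper end yields \<open>T = \<delta>\<close>.
\<close>

lemma sum_moebius_upper:
  assumes "refines n \<beta> \<alpha>" "small_cycles n \<alpha>"
  shows "(\<Sum>\<gamma> | refines n \<beta> \<gamma> \<and> refines n \<gamma> \<alpha>. moebius n \<gamma> \<alpha>) = of_bool (\<beta> = \<alpha>)"
  using assms
proof (induction \<alpha> rule: measure_induct_rule[where f = "\<lambda>\<alpha>. n - ncycles {1..n} \<alpha>"])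
  case (less \<alpha>)
  note r = less.prems(1) and small = less.prems(2)
  let ?I = "{\<gamma>. refines n \<beta> \<gamma> \<and> refines n \<gamma> \<alpha>}"
  let ?T = "\<lambda>\<delta>. \<Sum>\<gamma> | refines n \<beta> \<gamma> \<and> refines n \<gamma> \<delta>. moebius n \<gamma> \<delta>"
  have a: "\<alpha> permutes {1..n}" using r by (simp add: refines_def)
  note reflx = refines_refl[OF a small]
  have fin: "finite ?I" using finite_refinements[of n \<alpha> "\<lambda>\<gamma>. refines n \<beta> \<gamma>"] by (simp add: conj_commute)
  have up: "refines n \<beta> \<delta>" if "refines n \<beta> \<gamma>" "refines n \<gamma> \<delta>" "refines n \<delta> \<alpha>" for \<gamma> \<delta>
    by (rule refines_trans[OF that(1,2) small_cycles_if_refines[OF that(3) small]])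
  \<comment> \<open>By transitivity both indices may be restricted to \<open>?I\<close>. After the
    interchange each inner sum is evaluated by \<open>sum_moebius_lower\<close>, and only
    \<open>\<gamma> = \<alpha>\<close> survives.\<close>
  have "(\<Sum>\<delta>\<in>?I. ?T \<delta>) = (\<Sum>\<delta>\<in>?I. \<Sum>\<gamma> | \<gamma> \<in> ?I \<and> refines n \<gamma> \<delta>. moebius n \<gamma> \<delta>)"
    by (intro sum.cong) (auto intro: refines_trans[OF _ _ small])
  also have "\<dots> = (\<Sum>\<gamma>\<in>?I. \<Sum>\<delta> | \<delta> \<in> ?I \<and> refines n \<gamma> \<delta>. moebius n \<gamma> \<delta>)"
    by (rule sum.swap_restrict[OF fin fin])
  also have "\<dots> = (\<Sum>\<gamma>\<in>?I. \<Sum>\<delta> | refines n \<gamma> \<delta> \<and> refines n \<delta> \<alpha>. moebius n \<gamma> \<delta>)"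
    by (intro sum.cong refl) (auto intro: up)
  also have "\<dots> = (\<Sum>\<gamma>\<in>?I. of_bool (\<gamma> = \<alpha>))"
    by (intro sum.cong) (auto simp: sum_moebius_lower[OF _ reflx])
  also have "\<dots> = 1" using fin r reflx by (simp add: of_bool_def)
  finally have one: "(\<Sum>\<delta>\<in>?I. ?T \<delta>) = 1" .
  have "?T \<delta> = of_bool (\<beta> = \<delta>)" if "\<delta> \<in> ?I - {\<alpha>}" for \<delta>
  proof (rule less.IH)
    have "ncycles {1..n} \<alpha> < ncycles {1..n} \<delta>"
      using that ncycles_less_if_refines by blast
    moreover have "ncycles {1..n} \<delta> \<le> n"
      unfolding ncycles_def cycles_def using card_image_le[of "{1..n}" "Orbits.orbit \<delta>"] by simp
    ultimately show "n - ncycles {1..n} \<delta> < n - ncycles {1..n} \<alpha>" by simp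
  qed (use that small_cycles_if_refines[OF _ small] in auto)
  then have "(\<Sum>\<delta>\<in>?I - {\<alpha>}. ?T \<delta>) = (\<Sum>\<delta>\<in>?I - {\<alpha>}. of_bool (\<beta> = \<delta>))"
    by (intro sum.cong) auto
  \<comment> \<open>The one nonzero term is that of \<open>\<beta>\<close> itself, which is present
    unless \<open>\<beta>\<close> is the removed \<open>\<alpha>\<close>.\<close>
  also have "\<dots> = of_bool (\<beta> \<noteq> \<alpha>)"
    using fin r refines_refl[OF refines_permutes(1)[OF r] small_cycles_if_refines[OF r small]]
    by (simp add: of_bool_def)
  finally have "(\<Sum>\<delta>\<in>?I. ?T \<delta>) = ?T \<alpha> + of_bool (\<beta> \<noteq> \<alpha>)"
    using sum.remove[OF fin, of \<alpha> ?T] r reflx by simp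
  with one show ?case by (cases "\<beta> = \<alpha>") auto
qed

section \<open>The least refinement carrying a flow\<close>

text \<open>Every cycle of \<open>\<beta>\<close> is a disjoint union of cycles of
  \<open>\<gamma>\<close>, so its sum is a sum of zeros.\<close>

lemma flows_mono:
  assumes r: "refines n \<gamma> \<beta>"
  shows "flows n \<sigma> \<gamma> \<subseteq> flows n \<sigma> \<beta>"
proof -
  note pg = permutes_imp_permutation[OF refines_permutes(1)[OF r]]
    and pb = permutes_imp_permutation[OF refines_permutes(2)[OF r]]
  have "sum f C = 0" if C: "C \<in> cycles {1..n} \<beta>" and f: "\<forall>D\<in>cycles {1..n} \<gamma>. sum f D = 0"
    for C and f :: "nat \<Rightarrow> 'a"
  proof -
    obtain x where x: "x \<in> {1..n}" "C = Orbits.orbit \<beta> x" using C by (auto simp: cycles_def)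
    have CS: "C \<subseteq> {1..n}" by (rule cycles_subset[OF refines_permutes(2)[OF r] C])
    have sub: "Orbits.orbit \<gamma> y \<subseteq> C" if "y \<in> C" for y
      using orbit_subset_if_refines[OF r, of y] that CS
        orbit_cyclic_eq3[OF cyclic_on_orbit'[OF pb], of y x] x(2) by blast
    have fibre: "{y \<in> C. Orbits.orbit \<gamma> y = Orbits.orbit \<gamma> z} = Orbits.orbit \<gamma> z" if "z \<in> C" for z
      using sub[OF that] orbit_cyclic_eq3[OF cyclic_on_orbit'[OF pg]]
        permutation_self_in_orbit[OF pg] by blast
    have "sum f C = (\<Sum>D\<in>Orbits.orbit \<gamma> ` C. \<Sum>y | y \<in> C \<and> Orbits.orbit \<gamma> y = D. f y)"
      using finite_subset[OF CS] by (intro sum.image_gen) simp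
    also have "\<dots> = (\<Sum>D\<in>Orbits.orbit \<gamma> ` C. 0)"
    proof (rule sum.cong)
      fix D assume "D \<in> Orbits.orbit \<gamma> ` C"
      then obtain z where z: "z \<in> C" "D = Orbits.orbit \<gamma> z" by blast
      then have "D \<in> cycles {1..n} \<gamma>" using CS by (auto simp: cycles_def)
      then show "(\<Sum>y | y \<in> C \<and> Orbits.orbit \<gamma> y = D. f y) = 0"
        using f fibre[OF z(1)] z(2) by simp
    qed simp
    finally show ?thesis by simp
  qed
  then show ?thesis unfolding flows_def by blast
qed

text \<open>The branches are the cycle lengths one, two and three at \<open>x\<close>. The last one
  also records that the cycle closes, so that later steps obtain this together with the equation for
  \<open>f\<close>.\<close>

lemma sum_cycles_eq_0_iff:
  fixes f :: "nat \<Rightarrow> 'k::field"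
  assumes p: "p permutes {1..n}" and small: "small_cycles n p"
  shows "(\<forall>C\<in>cycles {1..n} p. sum f C = 0) \<longleftrightarrow>
    (\<forall>x\<in>{1..n}. if p x = x then f x = 0
      else if p (p x) = x then f x + f (p x) = 0
      else p (p (p x)) = x \<and> f x + f (p x) + f (p (p x)) = 0)"
proof -
  note pp = permutes_imp_permutation[OF p]
  have inj: "p u = p v \<longleftrightarrow> u = v" for u v
    using permutes_inj[OF p] by (auto simp: inj_def)
  have "sum f (Orbits.orbit p x) = 0 \<longleftrightarrow> (if p x = x then f x = 0
      else if p (p x) = x then f x + f (p x) = 0
      else p (p (p x)) = x \<and> f x + f (p x) + f (p (p x)) = 0)" if "x \<in> {1..n}" for x
  proof -
    have "card (Orbits.orbit p x) \<le> 3" using small that by (auto simp: cycles_def)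
    note o = orbit_small[OF pp this]
    show ?thesis
      using o(1) unfolding o(2) by (auto simp: inj add.assoc insert_commute)
  qed
  then show ?thesis unfolding cycles_def by blast
qed

text \<open>For a flow this is the least refinement \<open>\<beta>\<^sub>f\<close>. If a nonzero
  point is followed by a zero, its cycle has length three and the other nonzero point is two steps
  ahead; if the zero is two steps ahead, the partner is \<open>\<alpha> x\<close>.\<close>

definition supp_perm :: "('a \<Rightarrow> 'k::zero) \<Rightarrow> ('a \<Rightarrow> 'a) \<Rightarrow> 'a \<Rightarrow> 'a" where
  "supp_perm f \<alpha> x = (if f x = 0 then x else if f (\<alpha> x) = 0 then \<alpha> (\<alpha> x) else \<alpha> x)"

context
  fixes n :: nat and \<alpha> :: "nat \<Rightarrow> nat" and f :: "nat \<Rightarrow> 'k::field"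
  assumes a: "\<alpha> permutes {1..n}" and small: "small_cycles n \<alpha>"
    and flow: "\<forall>C\<in>cycles {1..n} \<alpha>. sum f C = 0"
begin

text \<open>A nonzero value cannot be the sum over a cycle of length one, nor can it cancel against
  a zero in a cycle of length two.\<close>

lemma nonzero_cycle:
  assumes x: "x \<in> {1..n}" "f x \<noteq> 0"
  shows "\<alpha> x \<noteq> x" "f (\<alpha> x) = 0 \<Longrightarrow> \<alpha> (\<alpha> x) \<noteq> x"
    "\<alpha> (\<alpha> x) \<noteq> x \<Longrightarrow> \<alpha> (\<alpha> (\<alpha> x)) = x \<and> f x + f (\<alpha> x) + f (\<alpha> (\<alpha> x)) = 0"
    "\<alpha> (\<alpha> x) = x \<Longrightarrow> f x + f (\<alpha> x) = 0"
proof -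
  have *: "if \<alpha> x = x then f x = 0
      else if \<alpha> (\<alpha> x) = x then f x + f (\<alpha> x) = 0
      else \<alpha> (\<alpha> (\<alpha> x)) = x \<and> f x + f (\<alpha> x) + f (\<alpha> (\<alpha> x)) = 0"
    using flow x(1) unfolding sum_cycles_eq_0_iff[OF a small] by blast
  then show "\<alpha> x \<noteq> x" using x(2) by auto
  with * show "f (\<alpha> x) = 0 \<Longrightarrow> \<alpha> (\<alpha> x) \<noteq> x"
    "\<alpha> (\<alpha> x) \<noteq> x \<Longrightarrow> \<alpha> (\<alpha> (\<alpha> x)) = x \<and> f x + f (\<alpha> x) + f (\<alpha> (\<alpha> x)) = 0"
    "\<alpha> (\<alpha> x) = x \<Longrightarrow> f x + f (\<alpha> x) = 0"
    using x(2) by (auto split: if_splits)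
qed

lemma in_range: "x \<in> {1..n} \<Longrightarrow> \<alpha> x \<in> {1..n}"
  using permutes_in_image[OF a] by blast

lemma supp_perm_off_support:
  assumes x: "x \<in> {1..n}" "f x \<noteq> 0" and z: "f (\<alpha> x) = 0"
  shows "\<alpha> (\<alpha> (\<alpha> x)) = x" "f (\<alpha> (\<alpha> x)) = - f x"
    "supp_perm f \<alpha> x = \<alpha> (\<alpha> x)" "supp_perm f \<alpha> (\<alpha> (\<alpha> x)) = x"
proof -
  show 1: "\<alpha> (\<alpha> (\<alpha> x)) = x" using nonzero_cycle(2,3)[OF x] z by blast
  show 2: "f (\<alpha> (\<alpha> x)) = - f x"
    using nonzero_cycle(2,3)[OF x] z by (simp add: eq_neg_iff_add_eq_0 add.commute)
  show "supp_perm f \<alpha> x = \<alpha> (\<alpha> x)" "supp_perm f \<alpha> (\<alpha> (\<alpha> x)) = x"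
    using x z by (simp_all add: supp_perm_def 1 2)
qed

lemma supp_perm_nonzero: "x \<in> {1..n} \<Longrightarrow> f x \<noteq> 0 \<Longrightarrow> f (supp_perm f \<alpha> x) \<noteq> 0"
  using supp_perm_off_support(2)[of x] by (auto simp: supp_perm_def)

lemma supp_perm_permutes: "supp_perm f \<alpha> permutes {1..n}"
proof (rule bij_imp_permutes)
  have "inj_on (supp_perm f \<alpha>) {1..n}"
  proof (rule inj_onI)
    fix x y assume xy: "x \<in> {1..n}" "y \<in> {1..n}" "supp_perm f \<alpha> x = supp_perm f \<alpha> y"
    have inj: "\<alpha> u = \<alpha> v \<longleftrightarrow> u = v" for u v using permutes_inj[OF a] by (auto simp: inj_def)
    \<comment> \<open>Zeros are fixed and nonzero points go to nonzero points. Among the latter the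
      two branches cannot collide: \<open>\<alpha> (\<alpha> x) = \<alpha> y\<close> would make
      \<open>y\<close> the zero \<open>\<alpha> x\<close>.\<close>
    have "f x = 0 \<longleftrightarrow> f y = 0"
      using supp_perm_nonzero xy by (metis supp_perm_def)
    then show "x = y"
      using xy(3) by (auto simp: supp_perm_def inj split: if_splits)
  qed
  moreover have "supp_perm f \<alpha> ` {1..n} \<subseteq> {1..n}"
    using in_range by (auto simp: supp_perm_def simp del: atLeastAtMost_iff)
  ultimately show "bij_betw (supp_perm f \<alpha>) {1..n} {1..n}"
    by (simp add: bij_betw_def endo_inj_surj)
  show "supp_perm f \<alpha> x = x" if "x \<notin> {1..n}" for x
    using permutes_not_in[OF a that] by (simp add: supp_perm_def)
qed

text \<open>This is the minimality of \<open>supp_perm f \<alpha>\<close>. At a nonzero point, the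
  few values that \<open>refines_at\<close> allows for \<open>\<beta>\<close> are compared with the
  sums over the cycles of \<open>\<beta>\<close>.\<close>

lemma refines_supp_perm_if_flow:
  assumes r: "refines n \<beta> \<alpha>" and fb: "\<forall>C\<in>cycles {1..n} \<beta>. sum f C = 0"
  shows "refines n (supp_perm f \<alpha>) \<beta>"
proof -
  note b = refines_permutes(1)[OF r] and sb = small_cycles_if_refines[OF r small]
  have at: "refines_at \<beta> \<alpha> y" for y
    using r refines_iff_refines_at[OF a small] by blast
  have injb: "\<beta> u = \<beta> v \<longleftrightarrow> u = v" for u v using permutes_inj[OF b] by (auto simp: inj_def)
  have inja: "\<alpha> u = \<alpha> v \<longleftrightarrow> u = v" for u v using permutes_inj[OF a] by (auto simp: inj_def)
  have bx: "if \<beta> x = x then f x = 0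
      else if \<beta> (\<beta> x) = x then f x + f (\<beta> x) = 0
      else \<beta> (\<beta> (\<beta> x)) = x \<and> f x + f (\<beta> x) + f (\<beta> (\<beta> x)) = 0" if "x \<in> {1..n}" for x
    using fb that unfolding sum_cycles_eq_0_iff[OF b sb] by blast
  have "refines_at (supp_perm f \<alpha>) \<beta> x" if x: "x \<in> {1..n}" for x
  proof (cases "f x = 0")
    case True
    then show ?thesis by (simp add: refines_at_def supp_perm_def)
  next
    case nz: False
    then have fixb: "\<beta> x \<noteq> x" using bx[OF x] by auto
    show ?thesis
    proof (cases "f (\<alpha> x) = 0")
      case True
      note s = supp_perm_off_support[OF x nz True]
      note ne = nonzero_cycle(1)[OF x nz] nonzero_cycle(2)[OF x nz True]
      have "\<beta> x = \<alpha> (\<alpha> x) \<or> \<beta> (\<alpha> (\<alpha> x)) = x"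
      proof (rule disjCI)
        assume "\<beta> (\<alpha> (\<alpha> x)) \<noteq> x"
        show "\<beta> x = \<alpha> (\<alpha> x)"
        proof (cases "\<beta> x = \<alpha> x")
          case bax: True
          \<comment> \<open>A transposition of \<open>x\<close> with the zero
            \<open>\<alpha> x\<close> would force \<open>f x = 0\<close>. So \<open>\<beta>\<close>
            agrees with \<open>\<alpha>\<close> on the whole three-cycle.\<close>
          have "\<beta> (\<beta> x) \<noteq> x"
            using bx[OF x] fixb nz True bax by auto
          then have "\<beta> (\<alpha> x) = \<alpha> (\<alpha> x)"
            using at[of "\<alpha> x"] injb[of "\<alpha> x" x] ne(1) bax by (auto simp: refines_at_def inja)
          then have "\<beta> (\<alpha> (\<alpha> x)) = x"
            using at[of "\<alpha> (\<alpha> x)"] injb[of "\<alpha> (\<alpha> x)" "\<alpha> x"] injb[of "\<alpha> (\<alpha> x)" x] ne bax s(1)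
            by (auto simp: refines_at_def inja)
          with \<open>\<beta> (\<alpha> (\<alpha> x)) \<noteq> x\<close> show ?thesis by contradiction
        next
          case False
          then have "\<alpha> (\<beta> x) = \<alpha> (\<alpha> (\<alpha> x))"
            using at[of x] fixb s(1) by (auto simp: refines_at_def)
          then show ?thesis by (simp add: inja)
        qed
      qed
      then show ?thesis using s by (auto simp: refines_at_def)
    next
      case False
      then have s: "supp_perm f \<alpha> x = \<alpha> x" using nz by (simp add: supp_perm_def)
      have "\<beta> x = \<alpha> x"
      proof (rule ccontr)
        \<comment> \<open>Then \<open>\<beta>\<close> swaps \<open>x\<close> with
          \<open>\<alpha> (\<alpha> x)\<close> in a three-cycle of \<open>\<alpha>\<close>. These
          two values cancel, which leaves \<open>f (\<alpha> x) = 0\<close>.\<close>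
        assume ne: "\<beta> x \<noteq> \<alpha> x"
        then have ab: "\<alpha> (\<beta> x) = x" "\<beta> (\<beta> x) = x"
          using at[of x] fixb by (auto simp: refines_at_def)
        then have "\<alpha> (\<alpha> x) \<noteq> x" using ne inja[of "\<beta> x" "\<alpha> x"] by auto
        then have c: "\<alpha> (\<alpha> (\<alpha> x)) = x" "f x + f (\<alpha> x) + f (\<alpha> (\<alpha> x)) = 0"
          using nonzero_cycle(3)[OF x nz] by auto
        have "\<beta> x = \<alpha> (\<alpha> x)" using ab(1) c(1) inja[of "\<beta> x" "\<alpha> (\<alpha> x)"] by simp
        then have "f x + f (\<alpha> (\<alpha> x)) = 0" using bx[OF x] fixb ab(2) by simp
        with c(2) have "f (\<alpha> x) = 0" by (simp add: add.commute add.left_commute add_eq_0_iff)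
        with False show False by contradiction
      qed
      then show ?thesis using s by (simp add: refines_at_def)
    qed
  qed
  moreover have "refines_at (supp_perm f \<alpha>) \<beta> x" if "x \<notin> {1..n}" for x
    using permutes_not_in[OF supp_perm_permutes that] by (simp add: refines_at_def)
  ultimately show ?thesis
    unfolding refines_iff_refines_at[OF b sb] using supp_perm_permutes by blast
qed

lemma refines_supp_perm: "refines n (supp_perm f \<alpha>) \<alpha>"
  using refines_supp_perm_if_flow[OF refines_refl[OF a small] flow] .

lemma flow_supp_perm: "\<forall>C\<in>cycles {1..n} (supp_perm f \<alpha>). sum f C = 0"
  unfolding sum_cycles_eq_0_iff[OF supp_perm_permutes small_cycles_if_refines[OF refines_supp_perm small]]
proof
  fix x assume x: "x \<in> {1..n}"
  let ?b = "supp_perm f \<alpha>"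
  have ax: "\<alpha> x \<in> {1..n}" by (rule in_range[OF x])
  show "if ?b x = x then f x = 0
      else if ?b (?b x) = x then f x + f (?b x) = 0
      else ?b (?b (?b x)) = x \<and> f x + f (?b x) + f (?b (?b x)) = 0"
  proof (cases "f x = 0")
    case True
    then show ?thesis by (simp add: supp_perm_def)
  next
    case nz: False
    show ?thesis
    proof (cases "f (\<alpha> x) = 0")
      case True
      then show ?thesis
        using supp_perm_off_support[OF x nz True] nonzero_cycle(2)[OF x nz] by simp
    next
      case False
      \<comment> \<open>The facts at \<open>\<alpha> x\<close> serve the second application of
        \<open>supp_perm\<close>, which tests \<open>f\<close> at
        \<open>\<alpha> (\<alpha> x)\<close>; in a three-cycle a zero there leads back to
        \<open>x\<close>.\<close>
      note nx = nonzero_cycle[OF x nz] and nax = nonzero_cycle[OF ax False]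
      show ?thesis
        using nx nax nz False unfolding supp_perm_def by (cases "\<alpha> (\<alpha> x) = x") auto
    qed
  qed
qed

lemma supp_perm_eq_iff:
  "supp_perm f \<alpha> = \<alpha> \<longleftrightarrow> (\<forall>i\<in>{1..n}. f i = 0 \<longrightarrow> \<alpha> i = i)"
proof
  assume "supp_perm f \<alpha> = \<alpha>"
  then show "\<forall>i\<in>{1..n}. f i = 0 \<longrightarrow> \<alpha> i = i"
    by (metis supp_perm_def)
next
  assume nz: "\<forall>i\<in>{1..n}. f i = 0 \<longrightarrow> \<alpha> i = i"
  have inj: "\<alpha> u = \<alpha> v \<longleftrightarrow> u = v" for u v using permutes_inj[OF a] by (auto simp: inj_def)
  show "supp_perm f \<alpha> = \<alpha>"
  proof
    fix x
    show "supp_perm f \<alpha> x = \<alpha> x"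
    proof (cases "x \<in> {1..n}")
      case True
      \<comment> \<open>If \<open>f x\<close> is nonzero but \<open>f (\<alpha> x) = 0\<close>, then
        \<open>\<alpha> x\<close> is fixed by \<open>nz\<close>, so \<open>x\<close> is fixed by
        injectivity, contrary to \<open>nonzero_cycle\<close>.\<close>
      then show ?thesis
        using nz in_range[OF True] nonzero_cycle(1)[OF True] inj[of "\<alpha> x" x]
        by (auto simp: supp_perm_def simp del: atLeastAtMost_iff)
    next
      case False
      then show ?thesis using permutes_not_in[OF a] by (simp add: supp_perm_def)
    qed
  qed
qed

end

section \<open>Sorting flows by their least refinement\<close>

lemma singleton_in_cycles_iff:
  fixes i n :: nat
  assumes "p permutes {1..n}" "i \<in> {1..n}"
  shows "{i} \<in> cycles {1..n} p \<longleftrightarrow> p i = i"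
proof
  show "p i = i" if "{i} \<in> cycles {1..n} p"
    using in_cycles_iff[OF finite_atLeastAtMost assms that] orbit_eq_singleton_iff[of p i] by simp
  show "{i} \<in> cycles {1..n} p" if "p i = i"
    using that orbit_in_cycles[OF assms(2), of p] orbit_eq_singleton_iff[of p i] by simp
qed

text \<open>One direction is minimality of \<open>supp_perm f \<alpha>\<close>. For the other,
  \<open>f\<close> is a flow on \<open>supp_perm f \<alpha>\<close>, and flows persist when cycles
  are merged.\<close>

lemma flows_refinement_iff:
  fixes f :: "nat \<Rightarrow> 'k::field"
  assumes a: "\<alpha> permutes {1..n}" and small: "small_cycles n \<alpha>" and r: "refines n \<beta> \<alpha>"
  shows "f \<in> flows n \<sigma> \<beta> \<longleftrightarrow> f \<in> flows n \<sigma> \<alpha> \<and> refines n (supp_perm f \<alpha>) \<beta>"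
proof
  assume f: "f \<in> flows n \<sigma> \<beta>"
  then have fa: "f \<in> flows n \<sigma> \<alpha>" using flows_mono[OF r] by blast
  have "refines n (supp_perm f \<alpha>) \<beta>"
    using f fa by (intro refines_supp_perm_if_flow[OF a small _ r]) (auto simp: flows_def)
  with fa show "f \<in> flows n \<sigma> \<alpha> \<and> refines n (supp_perm f \<alpha>) \<beta>" by blast
next
  assume f: "f \<in> flows n \<sigma> \<alpha> \<and> refines n (supp_perm f \<alpha>) \<beta>"
  then have "f \<in> flows n \<sigma> (supp_perm f \<alpha>)"
    using flow_supp_perm[OF a small, of f] by (auto simp: flows_def)
  then show "f \<in> flows n \<sigma> \<beta>" using f flows_mono by blast
qed

lemma nowhere_zero_flows_eq:
  assumes a: "\<alpha> permutes {1..n}" and small: "small_cycles n \<alpha>"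
  shows "nowhere_zero_flows n \<sigma> \<alpha>
    = {f \<in> flows n \<sigma> \<alpha> :: (nat \<Rightarrow> 'k::field) set. supp_perm f \<alpha> = \<alpha>}"
proof -
  have "(\<forall>i\<in>{1..n}. f i = 0 \<longrightarrow> {i} \<in> cycles {1..n} \<alpha>) \<longleftrightarrow> supp_perm f \<alpha> = \<alpha>"
    if "f \<in> flows n \<sigma> \<alpha>" for f :: "nat \<Rightarrow> 'k"
  proof -
    have "\<forall>C\<in>cycles {1..n} \<alpha>. sum f C = 0" using that by (simp add: flows_def)
    then show ?thesis
      using supp_perm_eq_iff[OF a small] singleton_in_cycles_iff[OF a] by blast
  qed
  then show ?thesis unfolding nowhere_zero_flows_def by blast
qed

lemma finite_flows: "finite (flows n \<sigma> \<alpha> :: (nat \<Rightarrow> 'k::{field,finite}) set)"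
  by (rule finite_subset[of _ "{1..n} \<rightarrow>\<^sub>E UNIV"]) (auto simp: flows_def intro: finite_PiE)

theorem theorem7p7:
  fixes n q :: nat and \<sigma> \<alpha> :: "nat \<Rightarrow> nat"
  assumes "CARD('k::{field,finite}) = q"
    and "\<sigma> permutes {1..n}" and "\<alpha> permutes {1..n}"
    and "\<forall>C \<in> cycles {1..n} \<alpha>. card C \<le> 3"
  shows "poly (flow_polynomial n \<sigma> \<alpha>) (int q)
           = int (card (nowhere_zero_flows n \<sigma> \<alpha> :: (nat \<Rightarrow> 'k) set))"
proof -
  let ?F = "\<lambda>\<beta>. flows n \<sigma> \<beta> :: (nat \<Rightarrow> 'k) set"
  let ?R = "{\<beta>. refines n \<beta> \<alpha>}"
  note s = assms(2) and a = assms(3) and small = assms(4)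
  have finR: "finite ?R" using finite_refinements[of n \<alpha> "\<lambda>_. True"] by simp
  have "poly (flow_polynomial n \<sigma> \<alpha>) (int q)
      = (\<Sum>\<beta>\<in>?R. moebius n \<beta> \<alpha> * int (card (?F \<beta>)))"
    unfolding flow_polynomial_def poly_sum poly_monom
    by (intro sum.cong refl)
      (auto simp: card_flows[OF s refines_permutes(1)] assms(1) of_nat_power)
  also have "\<dots> = (\<Sum>\<beta>\<in>?R. \<Sum>f | f \<in> ?F \<alpha> \<and> refines n (supp_perm f \<alpha>) \<beta>. moebius n \<beta> \<alpha>)"
  proof (intro sum.cong refl)
    fix \<beta> assume "\<beta> \<in> ?R"
    then have "?F \<beta> = {f. f \<in> ?F \<alpha> \<and> refines n (supp_perm f \<alpha>) \<beta>}"
      using flows_refinement_iff[OF a small] by blast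
    then show "moebius n \<beta> \<alpha> * int (card (?F \<beta>))
        = (\<Sum>f | f \<in> ?F \<alpha> \<and> refines n (supp_perm f \<alpha>) \<beta>. moebius n \<beta> \<alpha>)"
      by (simp add: mult.commute)
  qed
  \<comment> \<open>For each flow the inner sum now runs over the interval from
    \<open>supp_perm f \<alpha>\<close> to \<open>\<alpha>\<close>, as
    \<open>sum_moebius_upper\<close> requires.\<close>
  also have "\<dots> = (\<Sum>f\<in>?F \<alpha>. \<Sum>\<beta> | \<beta> \<in> ?R \<and> refines n (supp_perm f \<alpha>) \<beta>. moebius n \<beta> \<alpha>)"
    by (rule sum.swap_restrict[OF finR finite_flows])
  also have "\<dots> = (\<Sum>f\<in>?F \<alpha>. of_bool (supp_perm f \<alpha> = \<alpha>))"
  proof (intro sum.cong refl)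
    fix f assume "f \<in> ?F \<alpha>"
    then have "refines n (supp_perm f \<alpha>) \<alpha>"
      using refines_supp_perm[OF a small] by (auto simp: flows_def)
    from sum_moebius_upper[OF this small]
    show "(\<Sum>\<beta> | \<beta> \<in> ?R \<and> refines n (supp_perm f \<alpha>) \<beta>. moebius n \<beta> \<alpha>)
        = of_bool (supp_perm f \<alpha> = \<alpha>)"
      by (simp add: conj_commute)
  qed
  also have "\<dots> = int (card (nowhere_zero_flows n \<sigma> \<alpha> :: (nat \<Rightarrow> 'k) set))"
    unfolding nowhere_zero_flows_eq[OF a small] by (simp add: finite_flows Int_def)
  finally show ?thesis .
qed

end
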